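(* Let $\mathcal{A}$ be a strongly connected NFA. For any $\varepsilon>0$, there exists an $\varepsilon$-tester for $L(\mathcal{A})$ that uses $\mathcal{O}(\varepsilon^{-1}\log(\varepsilon^{-1}))$ queries, where the hidden constant depends only on $\mathcal{A}$.
   Context: An NFA is strongly connected if its underlying graph is strongly connected. For words $u,v$, $d(u,v)$ is the Hamming distance if $|u|=|v|$ and $+\infty$ otherwise; $u$ of length $n$ is $\varepsilon$-far from $L$ if $d(u,v)\ge\varepsilon n$ for all $v\in L$. An $\varepsilon$-tester for $L$ is a randomized algorithm with query access to the letters of the input $u$ (of known length $n$) that always accepts if $u\in L$ and rejects with probability at least $2/3$ if $u$ is $\varepsilon$-far from $L$; the number of queries is counted in the worst case over inputs and random choices. *)

theory Defs
  imports "HOL-Probability.Probability" "HOL-Library.Landau_Symbols"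
begin

text \<open>The state set and the alphabet of an automaton are the finite types \<^typ>\<open>'q\<close> and
  \<^typ>\<open>'a\<close>. Sets of initial states are allowed; a single initial state is the case of a singleton.\<close>

record ('q, 'a) nfa =
  trans :: "'q \<Rightarrow> 'a \<Rightarrow> 'q set"
  init :: "'q set"
  final :: "'q set"

primrec reached :: "('q, 'a) nfa \<Rightarrow> 'q set \<Rightarrow> 'a list \<Rightarrow> 'q set" where
  "reached A S [] = S"
| "reached A S (a # w) = reached A (\<Union>p\<in>S. nfa.trans A p a) w"

definition lang :: "('q, 'a) nfa \<Rightarrow> 'a list set" where
  "lang A = {w. reached A (init A) w \<inter> final A \<noteq> {}}"

definition edges :: "('q, 'a) nfa \<Rightarrow> ('q \<times> 'q) set" where
  "edges A = {(p, q). \<exists>a. q \<in> nfa.trans A p a}"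

definition strongly_connected :: "('q, 'a) nfa \<Rightarrow> bool" where
  "strongly_connected A \<longleftrightarrow> (\<forall>p q. (p, q) \<in> (edges A)\<^sup>*)"

definition hamming :: "'a list \<Rightarrow> 'a list \<Rightarrow> ereal" where
  "hamming u v =
    (if length u = length v then ereal (real (card {i. i < length u \<and> u ! i \<noteq> v ! i})) else \<infinity>)"

definition far :: "real \<Rightarrow> 'a list \<Rightarrow> 'a list set \<Rightarrow> bool" where
  "far \<epsilon> u L \<longleftrightarrow> (\<forall>v\<in>L. ereal (\<epsilon> * real (length u)) \<le> hamming u v)"

text \<open>Randomized, adaptive query algorithms as decision trees: answer; read the letter at a
  position (counted from 0) and continue depending on it; or draw a uniformly random number
  from \<open>{0..m}\<close> and continue depending on it. Only queries are counted; computation and random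
  choices are free.\<close>

datatype 'a query_alg =
    Answer bool
  | Query nat "'a \<Rightarrow> 'a query_alg"
  | Sample nat "nat \<Rightarrow> 'a query_alg"

text \<open>The joint distribution of the answer and the number of queries made on input \<open>u\<close>. The value
  of \<open>u ! i\<close> for \<open>i \<ge> length u\<close> is unspecified but depends only on \<open>i - length u\<close>, so a query
  outside the input reveals nothing beyond the known length.\<close>

primrec run :: "'a query_alg \<Rightarrow> 'a list \<Rightarrow> (bool \<times> nat) pmf" where
  "run (Answer b) u = return_pmf (b, 0)"
| "run (Query i k) u = map_pmf (\<lambda>(b, c). (b, Suc c)) (run (k (u ! i)) u)"
| "run (Sample m k) u = bind_pmf (pmf_of_set {0..m}) (\<lambda>j. run (k j) u)"

text \<open>The input length is known, so a tester is a family of query algorithms indexed by it.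
  The empty word is \<open>\<epsilon>\<close>-far from every language, including those that contain it, so rejection
  is required only outside \<open>L\<close>; for nonempty \<open>u\<close> and \<open>\<epsilon> > 0\<close> this is implied by \<open>far \<epsilon> u L\<close>.\<close>

definition is_tester :: "real \<Rightarrow> 'a list set \<Rightarrow> (nat \<Rightarrow> 'a query_alg) \<Rightarrow> bool" where
  "is_tester \<epsilon> L T \<longleftrightarrow>
    (\<forall>u. u \<in> L \<longrightarrow> (\<forall>(b, c)\<in>set_pmf (run (T (length u)) u). b)) \<and>
    (\<forall>u. u \<notin> L \<and> far \<epsilon> u L \<longrightarrow>
      measure_pmf.prob (run (T (length u)) u) {(b, c). \<not> b} \<ge> 2 / 3)"

definition uses_at_most :: "(nat \<Rightarrow> 'a query_alg) \<Rightarrow> nat \<Rightarrow> bool" where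
  "uses_at_most T q \<longleftrightarrow> (\<forall>u. \<forall>(b, c)\<in>set_pmf (run (T (length u)) u). c \<le> q)"

end

theory Submission
  imports Defs "HOL-Real_Asymp.Real_Asymp"
begin

text \<open>Fix an initial state \<open>s\<close>. A factor of the input is blocking if no state that is reachable from
  \<open>s\<close> in the right number of steps can read it; a word with a blocking factor is not accepted from
  \<open>s\<close>. Conversely, any two states reachable in \<open>i\<close> and \<open>i + N\<close> steps are connected by a walk of
  length \<open>N\<close>, so a word can be repaired at the cost of \<open>N\<close> letters per blocking factor, and a word
  of length \<open>n\<close> that is \<open>\<epsilon>\<close>-far has order of \<open>\<epsilon> n / N\<close> disjoint blocking factors, most of them of
  length at most \<open>2 ^ T\<close>, of order \<open>N / \<epsilon>\<close>. Reading, for each \<open>t \<le> T\<close>, order of \<open>2 ^ (T - t)\<close>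
  random windows of radius \<open>2 ^ t\<close> costs order of \<open>2 ^ T\<close> queries for each of the \<open>T + 1\<close> scales.
  The factors of length about \<open>2 ^ t\<close> are missed with probability exponentially small in the number
  of them relative to \<open>n / 2 ^ T\<close>, so all factors together are missed with small constant
  probability.\<close>

section \<open>Walks in a strongly connected automaton\<close>

lemma reached_append: "reached A S (v @ w) = reached A (reached A S v) w"
  by (induction v arbitrary: S) auto

lemma reached_UN: "reached A S w = (\<Union>p\<in>S. reached A {p} w)"
proof (induction w arbitrary: S)
  case (Cons a w)
  have "reached A S (a # w) = (\<Union>q\<in>(\<Union>p\<in>S. nfa.trans A p a). reached A {q} w)"
    unfolding reached.simps by (rule Cons)
  also have "\<dots> = (\<Union>p\<in>S. \<Union>q\<in>nfa.trans A p a. reached A {q} w)"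
    by blast
  also have "\<dots> = (\<Union>p\<in>S. reached A {p} (a # w))"
    by (simp add: Cons[symmetric])
  finally show ?case .
qed simp

lemma mem_reached_append:
  "r \<in> reached A {p} (v @ w) \<longleftrightarrow> (\<exists>q\<in>reached A {p} v. r \<in> reached A {q} w)"
  by (subst reached_append, subst reached_UN) blast

definition walk :: "('q, 'a) nfa \<Rightarrow> 'q \<Rightarrow> 'q \<Rightarrow> nat \<Rightarrow> bool" where
  "walk A p q k \<longleftrightarrow> (\<exists>w. length w = k \<and> q \<in> reached A {p} w)"

lemma walkI: "q \<in> reached A {p} w \<Longrightarrow> length w = k \<Longrightarrow> walk A p q k"
  unfolding walk_def by blast

lemma walkE:
  assumes "walk A p q k"
  obtains w where "length w = k" "q \<in> reached A {p} w"
  using assms unfolding walk_def by blast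

lemma walk_refl: "walk A p p 0"
  by (rule walkI[of _ _ _ "[]"]) auto

lemma walk_add: "walk A p q k \<Longrightarrow> walk A q r l \<Longrightarrow> walk A p r (k + l)"
  unfolding walk_def by (metis length_append mem_reached_append)

lemma walk_mult: "walk A p p k \<Longrightarrow> walk A p p (m * k)"
  by (induction m) (auto intro: walk_refl walk_add)

lemma walk_prefix:
  assumes "walk A p q k" "i \<le> k"
  obtains r where "walk A p r i"
proof -
  obtain w where w: "length w = k" "q \<in> reached A {p} w"
    using assms(1) by (rule walkE)
  then have "q \<in> reached A {p} (take i w @ drop i w)" by simp
  then obtain r where "r \<in> reached A {p} (take i w)"
    unfolding mem_reached_append by blast
  then have "walk A p r i"
    using w(1) assms(2) by (intro walkI) auto
  then show ?thesis by (rule that)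
qed

lemma strongly_connected_walk:
  assumes "strongly_connected A"
  shows "\<exists>k. walk A p q k"
proof -
  have "(p, q) \<in> (edges A)\<^sup>*"
    using assms unfolding strongly_connected_def by blast
  then show ?thesis
  proof (induction rule: rtrancl_induct)
    case base
    show ?case using walk_refl by (rule exI)
  next
    case (step q r)
    from step(2) obtain a where "r \<in> nfa.trans A q a"
      unfolding edges_def by blast
    then have "walk A q r 1"
      by (intro walkI[of _ _ _ "[a]"]) auto
    with step(3) show ?case by (blast intro: walk_add)
  qed
qed

text \<open>The period of the automaton is not needed explicitly. The residues modulo a fixed cycle length \<open>c\<close> of
  the lengths of closed walks at \<open>s\<close> form a subgroup of the integers modulo \<open>c\<close>, and every
  sufficiently large number with such a residue is itself the length of a closed walk.\<close>

lemma long_walks: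
  fixes A :: "('q::finite, 'a) nfa"
  assumes "strongly_connected A"
  obtains N where "N \<ge> 1"
    "\<And>p q i j. walk A s p i \<Longrightarrow> walk A s q j \<Longrightarrow> i + N \<le> j \<Longrightarrow> walk A p q (j - i)"
proof (cases "\<exists>c>0. walk A s s c")
  \<comment> \<open>Without a closed walk of positive length at \<open>s\<close>, every walk from
    \<open>s\<close> is empty, so \<open>N = 1\<close> works vacuously.\<close>
  case False
  have "j = 0" if "walk A s q j" for q j
  proof -
    obtain k where "walk A q s k" using strongly_connected_walk[OF assms] by blast
    with that have "walk A s s (j + k)" by (rule walk_add)
    with False show ?thesis by auto
  qed
  then show ?thesis using that[of 1] by fastforce
next
  case True
  then obtain c where c: "c > 0" "walk A s s c" by blast
  \<comment> \<open>If no closed walk has residue \<open>r\<close>, then \<open>m r\<close> is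
    arbitrary; including such values in \<open>M\<close> only enlarges it.\<close>
  define m where "m r = (SOME y. walk A s s y \<and> y mod c = r)" for r
  have m: "walk A s s (m (y mod c))" "m (y mod c) mod c = y mod c" if "walk A s s y" for y
    using someI[of "\<lambda>z. walk A s s z \<and> z mod c = y mod c" y] that unfolding m_def by auto
  define M where "M = Max (m ` {..<c})"
  have large: "walk A s s x" if "x \<ge> M" "x mod c = y mod c" "walk A s s y" for x y
  proof -
    have "m (y mod c) \<le> M"
      unfolding M_def using c by (intro Max_ge) auto
    then have "m (y mod c) \<le> x" using that(1) by simp
    moreover have "x mod c = m (y mod c) mod c" using m(2)[OF that(3)] that(2) by simp
    ultimately obtain k where "x = m (y mod c) + c * k" using mod_eq_nat1E by blast
    then show ?thesis
      using walk_add[OF m(1)[OF that(3)] walk_mult[OF c(2)]] by (metis mult.commute)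
  qed
  obtain a where a: "\<And>q. walk A s q (a q)"
    using strongly_connected_walk[OF assms, of s] by metis
  obtain b where b: "\<And>q. walk A q s (b q)"
    using strongly_connected_walk[OF assms, of _ s] by metis
  define N where "N = 1 + M + Max (range a) + Max (range b)"
  have "walk A p q (j - i)" if "walk A s p i" "walk A s q j" "i + N \<le> j" for p q i j
  proof -
    have "a q \<le> Max (range a)" "b p \<le> Max (range b)" by (auto intro: Max_ge)
    then have "i + b p + a q + M \<le> j" using that(3) unfolding N_def by linarith
    then obtain x where x: "j = i + b p + a q + x" "x \<ge> M"
      by (auto simp: le_iff_add)
    \<comment> \<open>Here \<open>x\<close> equals \<open>j + b q\<close> minus the closed walk
      lengths \<open>i + b p\<close> and \<open>a q + b q\<close>. Modulo \<open>c\<close>,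
      subtracting a length is adding it \<open>c - 1\<close> times, so \<open>y\<close> is a closed
      walk length congruent to \<open>x\<close>.\<close>
    define y where "y = (j + b q) + ((c - 1) * (i + b p) + (c - 1) * (a q + b q))"
    have "walk A s s y"
      unfolding y_def using walk_add[OF that(2) b] walk_mult[OF walk_add[OF that(1) b]]
        walk_mult[OF walk_add[OF a b]] by (blast intro: walk_add)
    moreover have "y = x + c * (i + b p + a q + b q)"
      using c(1) by (cases c) (auto simp: y_def x(1) algebra_simps)
    then have "x mod c = y mod c" by simp
    ultimately have "walk A s s x" using large x(2) by blast
    then have "walk A p q (b p + (x + a q))"
      using a b by (blast intro: walk_add)
    then show ?thesis using x(1) by (simp add: add_ac)
  qed
  then show ?thesis using that[of N] unfolding N_def by simp
qed

text \<open>Walks of lengths \<open>i\<close> and \<open>j\<close> from a common state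
  \<open>s\<close> stand in for the period classes of \<open>p\<close> and \<open>q\<close>. One
  \<open>N\<close> serves all \<open>s\<close>; \<open>N >= 1\<close> makes the greedy repair
  advance.\<close>

definition connecting :: "('q, 'a) nfa \<Rightarrow> nat \<Rightarrow> bool" where
  "connecting A N \<longleftrightarrow> N \<ge> 1 \<and>
    (\<forall>s p q i j. walk A s p i \<longrightarrow> walk A s q j \<longrightarrow> i + N \<le> j \<longrightarrow> walk A p q (j - i))"

lemma connecting_ge_1: "connecting A N \<Longrightarrow> N \<ge> 1"
  by (simp add: connecting_def)

lemma connecting_walk:
  "connecting A N \<Longrightarrow> walk A s p i \<Longrightarrow> walk A s q j \<Longrightarrow> i + N \<le> j \<Longrightarrow> walk A p q (j - i)"
  unfolding connecting_def by blast

lemma strongly_connected_imp_connecting: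
  fixes A :: "('q::finite, 'a) nfa"
  assumes "strongly_connected A"
  obtains N where "connecting A N"
proof -
  define P where "P s N \<longleftrightarrow> N \<ge> 1 \<and>
    (\<forall>p q i j. walk A s p i \<longrightarrow> walk A s q j \<longrightarrow> i + N \<le> j \<longrightarrow> walk A p q (j - i))" for s N
  have "\<exists>N. P s N" for s
    unfolding P_def by (rule long_walks[OF assms, of s]) blast
  then obtain N where P: "\<And>s. P s (N s)" by metis
  then have N: "N s \<ge> 1"
      "walk A s p i \<Longrightarrow> walk A s q j \<Longrightarrow> i + N s \<le> j \<Longrightarrow> walk A p q (j - i)" for s p q i j
    unfolding P_def by blast+
  have max: "N s \<le> Max (range N)" for s by (rule Max_ge) auto
  have "connecting A (Max (range N))"
    unfolding connecting_def
  proof (intro conjI allI impI)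
    show "1 \<le> Max (range N)" using le_trans[OF N(1) max] .
    fix s p q i j
    assume "walk A s p i" "walk A s q j" "i + Max (range N) \<le> j"
    then show "walk A p q (j - i)" using N(2)[of s p i q j] max[of s] by linarith
  qed
  then show ?thesis by (rule that)
qed

section \<open>Blocking factors\<close>

text \<open>Written with indices, this is literally the list of answers that \<open>read_all\<close>
  collects.\<close>

definition slice :: "'a list \<Rightarrow> nat \<Rightarrow> nat \<Rightarrow> 'a list" where
  "slice u i j = map ((!) u) [i..<j]"

lemma length_slice [simp]: "length (slice u i j) = j - i"
  by (simp add: slice_def)

lemma slice_append: "i \<le> j \<Longrightarrow> j \<le> k \<Longrightarrow> slice u i j @ slice u j k = slice u i k"
  unfolding slice_def by (metis map_append upt_add_eq_append le_add_diff_inverse)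

lemma slice_all: "slice u 0 (length u) = u"
  by (simp add: slice_def map_nth)

definition blocking :: "('q, 'a) nfa \<Rightarrow> 'q \<Rightarrow> nat \<Rightarrow> 'a list \<Rightarrow> bool" where
  "blocking A s i w \<longleftrightarrow> (\<forall>p. walk A s p i \<longrightarrow> reached A {p} w = {})"

text \<open>A run over the larger factor would enter the inner one in a state reachable from
  \<open>s\<close> in \<open>i\<close> steps, and no such state can read it.\<close>

lemma blocking_slice_mono:
  assumes "blocking A s i (slice u i j)" "i' \<le> i" "i \<le> j" "j \<le> j'"
  shows "blocking A s i' (slice u i' j')"
proof (rule ccontr)
  assume "\<not> ?thesis"
  then obtain p r where p: "walk A s p i'" and r: "r \<in> reached A {p} (slice u i' j')"
    unfolding blocking_def by blast
  have "slice u i' j' = slice u i' i @ slice u i j @ slice u j j'"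
    using assms by (simp add: slice_append)
  with r obtain q q' where q: "q \<in> reached A {p} (slice u i' i)"
      and q': "q' \<in> reached A {q} (slice u i j)"
    by (auto simp: mem_reached_append)
  have "walk A s q i"
    using walk_add[OF p walkI[OF q length_slice]] assms(2) by simp
  with q' assms(1) show False unfolding blocking_def by blast
qed

definition path_lang :: "('q, 'a) nfa \<Rightarrow> 'q \<Rightarrow> 'q \<Rightarrow> 'a list set" where
  "path_lang A s f = {w. f \<in> reached A {s} w}"

lemma lang_eq_UN: "lang A = (\<Union>s\<in>init A. \<Union>f\<in>final A. path_lang A s f)"
  unfolding lang_def path_lang_def by (subst reached_UN) blast

text \<open>A blocking factor would extend to the whole word at position 0, where \<open>s\<close>
  is reachable by the empty walk. This makes the error of the tester one-sided.\<close>

lemma not_blocking_if_in_lang: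
  assumes "u \<in> path_lang A s f" "i \<le> j" "j \<le> length u"
  shows "\<not> blocking A s i (slice u i j)"
proof
  assume "blocking A s i (slice u i j)"
  then have "blocking A s 0 (slice u 0 (length u))"
    by (rule blocking_slice_mono) (use assms in auto)
  then have "reached A {s} u = {}"
    unfolding blocking_def slice_all using walk_refl[of A s] by blast
  with assms(1) show False by (simp add: path_lang_def)
qed

section \<open>Distances of concatenated words and greedy repair\<close>

definition mismatches :: "'a list \<Rightarrow> 'a list \<Rightarrow> nat" where
  "mismatches u v = length (filter (\<lambda>(x, y). x \<noteq> y) (zip u v))"

lemma mismatches_append:
  "length u = length v \<Longrightarrow> mismatches (u @ u') (v @ v') = mismatches u v + mismatches u' v'"
  by (simp add: mismatches_def)

lemma mismatches_le_length: "mismatches u v \<le> length u"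
  unfolding mismatches_def by (metis le_trans length_filter_le length_zip min.cobounded1)

lemma mismatches_self [simp]: "mismatches u u = 0"
  unfolding mismatches_def by (induction u) auto

lemma hamming_eq_mismatches:
  assumes "length u = length v"
  shows "hamming u v = ereal (real (mismatches u v))"
proof -
  have "{i. i < length u \<and> u ! i \<noteq> v ! i} =
      {i. i < length (zip u v) \<and> (case zip u v ! i of (x, y) \<Rightarrow> x \<noteq> y)}"
    using assms by auto
  then show ?thesis
    using assms unfolding hamming_def mismatches_def by (simp add: length_filter_conv_card)
qed

text \<open>Greedy repair: keep a maximal factor that is not blocking, overwrite the next \<open>N\<close> letters
  by a connecting walk, and go on.\<close>

lemma greedy_repair:
  assumes N: "connecting A N"
    and n: "walk A s f n"
    and a: "walk A s p a" "a + N \<le> n"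
  shows "\<exists>v F. length v = n - a \<and> f \<in> reached A {p} v \<and> finite F \<and>
    (\<forall>(i, j)\<in>F. a < i \<and> i < j \<and> j \<le> n \<and> blocking A s i (slice u i j)) \<and>
    disjoint_family_on (\<lambda>(i, j). {i..<j}) F \<and>
    mismatches (slice u a n) v \<le> N * (card F + 2)"
  using a
proof (induction "n - a" arbitrary: a p rule: less_induct)
  case less
  define a' where "a' = a + N"
  show ?case
  proof (cases "a' + N \<le> n")
    \<comment> \<open>Fewer than \<open>2 * N\<close> letters remain; all are overwritten by one
      walk to \<open>f\<close>.\<close>
    case False
    obtain v where v: "length v = n - a" "f \<in> reached A {p} v"
      using connecting_walk[OF N less.prems(1) n less.prems(2)] by (rule walkE)
    have "mismatches (slice u a n) v \<le> N * 2"
      using mismatches_le_length[of "slice u a n" v] False by (simp add: a'_def)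
    with v show ?thesis
      by (intro exI[of _ v] exI[of _ "{}"]) (auto simp: disjoint_family_on_def)
  next
    case True
    have connect: "\<exists>w. length w = N \<and> q \<in> reached A {p} w" if "walk A s q a'" for q
      using connecting_walk[OF N less.prems(1) that] unfolding a'_def walk_def by auto
    show ?thesis
    proof (cases "blocking A s a' (slice u a' (n - N))")
      \<comment> \<open>Nothing before the last \<open>N\<close> letters blocks: that stretch is
        kept, with \<open>N\<close> connecting letters on either side.\<close>
      case False
      then obtain p' q where p': "walk A s p' a'" and q: "q \<in> reached A {p'} (slice u a' (n - N))"
        unfolding blocking_def by blast
      obtain w where w: "length w = N" "p' \<in> reached A {p} w" using connect[OF p'] by blast
      have "walk A s q (n - N)"
        using walk_add[OF p' walkI[OF q length_slice]] True by simp
      from connecting_walk[OF N this n] have "walk A q f N" using True by simp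
      then obtain w' where w': "length w' = N" "f \<in> reached A {q} w'" by (rule walkE)
      define v where "v = w @ slice u a' (n - N) @ w'"
      have len: "length v = n - a" using True w w' by (simp add: v_def a'_def)
      have f: "f \<in> reached A {p} v"
        unfolding v_def mem_reached_append using w q w' by blast
      have "slice u a n = slice u a a' @ slice u a' (n - N) @ slice u (n - N) n"
        using True by (simp add: slice_append a'_def)
      then have "mismatches (slice u a n) v =
          mismatches (slice u a a') w + mismatches (slice u (n - N) n) w'"
        unfolding v_def using w by (simp add: mismatches_append a'_def)
      also have "\<dots> \<le> N * 2"
        using mismatches_le_length[of "slice u a a'" w]
          mismatches_le_length[of "slice u (n - N) n" w'] by (simp add: a'_def)
      finally show ?thesis using len f
        by (intro exI[of _ v] exI[of _ "{}"]) (auto simp: disjoint_family_on_def)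
    next
      case blocked: True
      \<comment> \<open>\<open>b\<close> ends the shortest blocking factor that starts at
        \<open>a'\<close>. The letters before \<open>e = b - 1\<close> can still be read and are
        kept; the induction resumes at \<open>e\<close>.\<close>
      define b where "b = (LEAST b. blocking A s a' (slice u a' b))"
      have b: "blocking A s a' (slice u a' b)" "b \<le> n - N"
        unfolding b_def using blocked by (rule LeastI, rule Least_le)
      have min: "\<not> blocking A s a' (slice u a' k)" if "k < b" for k
        using that not_less_Least unfolding b_def by blast
      \<comment> \<open>Some state is reachable in \<open>a'\<close> steps; otherwise even the empty
        factor would be blocking, vacuously.\<close>
      obtain r where "walk A s r a'"
        using walk_prefix[OF n, of a'] True by auto
      then have "\<not> blocking A s a' (slice u a' k)" if "k \<le> a'" for k
        using that by (auto simp: blocking_def slice_def)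
      with b(1) have "a' < b" using not_le by blast
      then obtain e where e: "b = Suc e" "a' \<le> e" by (cases b) auto
      obtain p' q where p': "walk A s p' a'" and q: "q \<in> reached A {p'} (slice u a' e)"
        using min[of e] e unfolding blocking_def by blast
      obtain w where w: "length w = N" "p' \<in> reached A {p} w" using connect[OF p'] by blast
      have sq: "walk A s q e"
        using walk_add[OF p' walkI[OF q length_slice]] e by simp
      have "n - e < n - a" "e + N \<le> n"
        using e b(2) connecting_ge_1[OF N] True unfolding a'_def by linarith+
      from less.hyps[OF this(1) sq this(2)] obtain v F where
        v: "length v = n - e" "f \<in> reached A {q} v" and F: "finite F"
        "\<And>i j. (i, j) \<in> F \<Longrightarrow> e < i \<and> i < j \<and> j \<le> n \<and> blocking A s i (slice u i j)"
        "disjoint_family_on (\<lambda>(i, j). {i..<j}) F"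
        and m: "mismatches (slice u e n) v \<le> N * (card F + 2)"
        by blast
      define v' where "v' = w @ slice u a' e @ v"
      define F' where "F' = insert (a', b) F"
      have new: "(a', b) \<notin> F" using F(2) e by fastforce
      have len: "length v' = n - a"
        using v w e b(2) True unfolding v'_def a'_def by simp
      have f: "f \<in> reached A {p} v'"
        unfolding v'_def mem_reached_append using w q v by blast
      have "slice u a n = slice u a a' @ slice u a' e @ slice u e n"
        using e b(2) by (simp add: slice_append a'_def)
      then have "mismatches (slice u a n) v' =
          mismatches (slice u a a') w + mismatches (slice u e n) v"
        unfolding v'_def using w by (simp add: mismatches_append a'_def)
      also have "\<dots> \<le> N + N * (card F + 2)"
        using m mismatches_le_length[of "slice u a a'" w] by (simp add: a'_def)
      also have "\<dots> = N * (card F' + 2)"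
        using F(1) new by (simp add: F'_def)
      finally have mm: "mismatches (slice u a n) v' \<le> N * (card F' + 2)" .
      have "\<forall>(i, j)\<in>F'. a < i \<and> i < j \<and> j \<le> n \<and> blocking A s i (slice u i j)"
        using F(2) b e connecting_ge_1[OF N] unfolding F'_def a'_def by fastforce
      \<comment> \<open>The factors from the induction hypothesis start strictly after
        \<open>e\<close>, hence at \<open>b\<close> or later, where the new factor has
        ended.\<close>
      moreover have "disjoint_family_on (\<lambda>(i, j). {i..<j}) F'"
        unfolding F'_def disjoint_family_on_insert[OF new]
        using F(2,3) e(1) by fastforce
      moreover have "finite F'" using F(1) by (simp add: F'_def)
      ultimately show ?thesis
        using len f mm by (intro exI[of _ v'] exI[of _ F']) simp
    qed
  qed
qed

section \<open>The tester\<close>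

primrec read_all :: "nat list \<Rightarrow> ('a list \<Rightarrow> 'a query_alg) \<Rightarrow> 'a query_alg" where
  "read_all [] k = k []"
| "read_all (i # is) k = Query i (\<lambda>x. read_all is (\<lambda>w. k (x # w)))"

lemma run_read_all:
  "run (read_all is k) u =
    map_pmf (\<lambda>(b, c). (b, c + length is)) (run (k (map ((!) u) is)) u)"
  by (induction "is" arbitrary: k)
    (simp_all add: pmf.map_comp o_def case_prod_unfold map_pmf_ident[unfolded id_def])

text \<open>The third argument lists the radii of the windows that are read around random positions;
  the last one is the set of the initial states that no window has excluded so far.\<close>

primrec probe :: "('q, 'a) nfa \<Rightarrow> nat \<Rightarrow> nat list \<Rightarrow> 'q set \<Rightarrow> 'a query_alg" where
  "probe A n [] S = Answer (S \<noteq> {})"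
| "probe A n (r # rs) S = Sample (n - 1) (\<lambda>x.
    read_all [x - r..<min n (x + r)] (\<lambda>w. probe A n rs {s\<in>S. \<not> blocking A s (x - r) w}))"

lemma run_probe_Cons:
  "run (probe A n (r # rs) S) u = bind_pmf (pmf_of_set {0..n - 1}) (\<lambda>x.
    map_pmf (\<lambda>(b, c). (b, c + (min n (x + r) - (x - r))))
      (run (probe A n rs {s\<in>S. \<not> blocking A s (x - r) (slice u (x - r) (min n (x + r)))}) u))"
  by (simp add: run_read_all slice_def)

lemma probe_queries:
  "(b, c) \<in> set_pmf (run (probe A n rs S) u) \<Longrightarrow> c \<le> 2 * sum_list rs"
proof (induction rs arbitrary: S c)
  case (Cons r rs)
  then show ?case
    unfolding run_probe_Cons by (fastforce simp del: run.simps probe.simps)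
qed simp

text \<open>The state \<open>s\<close> is never removed, since by
  \<open>not_blocking_if_in_lang\<close> no window of \<open>u\<close> blocks it.\<close>

lemma probe_accepts:
  assumes "(b, c) \<in> set_pmf (run (probe A (length u) rs S) u)"
    and "s \<in> S" "u \<in> path_lang A s f" "u \<noteq> []"
  shows "b"
  using assms(1,2)
proof (induction rs arbitrary: S c)
  case (Cons r rs)
  let ?n = "length u"
  obtain x c' where x: "x \<le> ?n - 1"
    and c': "(b, c') \<in> set_pmf (run (probe A ?n rs
      {s\<in>S. \<not> blocking A s (x - r) (slice u (x - r) (min ?n (x + r)))}) u)"
    using Cons.prems(1) unfolding run_probe_Cons by (auto simp del: run.simps probe.simps)
  have "\<not> blocking A s (x - r) (slice u (x - r) (min ?n (x + r)))"
    using assms(3,4) x by (intro not_blocking_if_in_lang) auto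
  with Cons.IH[OF c'] Cons.prems(2) show ?case by simp
qed auto

section \<open>Probability of acceptance\<close>

definition miss :: "('q, 'a) nfa \<Rightarrow> 'a list \<Rightarrow> 'q \<Rightarrow> nat \<Rightarrow> real" where
  "miss A u s r = card {x. x < length u \<and>
    \<not> blocking A s (x - r) (slice u (x - r) (min (length u) (x + r)))} / length u"

lemma miss_nonneg: "0 \<le> miss A u s r"
  by (simp add: miss_def)

lemma prob_bind_pmf_of_set:
  assumes "finite S" "S \<noteq> {}"
  shows "measure_pmf.prob (bind_pmf (pmf_of_set S) f) X =
    (\<Sum>x\<in>S. measure_pmf.prob (f x) X) / card S"
proof -
  have "ennreal (measure_pmf.prob (bind_pmf (pmf_of_set S) f) X) =
      (\<Sum>x\<in>S. ennreal (measure_pmf.prob (f x) X)) / card S"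
    using assms
    by (simp add: measure_pmf.emeasure_eq_measure[symmetric] nn_integral_pmf_of_set)
  also have "\<dots> = ennreal ((\<Sum>x\<in>S. measure_pmf.prob (f x) X) / card S)"
    using assms by (simp add: sum_nonneg divide_ennreal card_gt_0_iff
        ennreal_of_nat_eq_real_of_nat)
  finally show ?thesis by (simp add: sum_nonneg)
qed

text \<open>\<open>miss A u s r\<close> is the probability that one window of radius
  \<open>r\<close> fails to exclude \<open>s\<close>. Independence of the samples gives the product,
  and the union bound over \<open>S\<close> gives the sum, so all states can share the same
  windows.\<close>

lemma probe_prob_accept:
  fixes A :: "('q::finite, 'a) nfa"
  assumes "u \<noteq> []"
  shows "measure_pmf.prob (run (probe A (length u) rs S) u) {(b, c). b}
    \<le> (\<Sum>s\<in>S. \<Prod>r\<leftarrow>rs. miss A u s r)"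
proof (induction rs arbitrary: S)
  case Nil
  show ?case
  proof (cases "S = {}")
    case False
    then have "1 \<le> card S" by (simp add: Suc_le_eq card_gt_0_iff)
    then show ?thesis using False by (simp add: measure_return_pmf)
  qed (simp add: measure_return_pmf)
next
  case (Cons r rs)
  let ?n = "length u"
  let ?W = "\<lambda>x. slice u (x - r) (min ?n (x + r))"
  let ?S = "\<lambda>x. {s\<in>S. \<not> blocking A s (x - r) (?W x)}"
  let ?P = "\<lambda>s. \<Prod>r\<leftarrow>rs. miss A u s r"
  have vimage: "(\<lambda>(b, c). (b, c + k)) -` {(b, c). b} = {(b, c). b}" for k :: nat
    by auto
  have range: "{0..?n - 1} = {..<?n}" using assms by (cases u) auto
  have "measure_pmf.prob (run (probe A ?n (r # rs) S) u) {(b, c). b} =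
      (\<Sum>x<?n. measure_pmf.prob (run (probe A ?n rs (?S x)) u) {(b, c). b}) / ?n"
    unfolding run_probe_Cons range using assms
    by (subst prob_bind_pmf_of_set) (auto simp: vimage[unfolded vimage_def] vimage_def case_prod_unfold)
  also have "\<dots> \<le> (\<Sum>x<?n. \<Sum>s\<in>?S x. ?P s) / ?n"
    by (intro divide_right_mono sum_mono Cons.IH) simp
  also have "(\<Sum>x<?n. \<Sum>s\<in>?S x. ?P s) =
      (\<Sum>s\<in>S. \<Sum>x\<in>{x. x < ?n \<and> \<not> blocking A s (x - r) (?W x)}. ?P s)"
    using sum.swap_restrict[of "{..<?n}" S "\<lambda>x s. ?P s"
        "\<lambda>x s. \<not> blocking A s (x - r) (?W x)"] by simp
  also have "\<dots> / ?n = (\<Sum>s\<in>S. \<Prod>r\<leftarrow>r # rs. miss A u s r)"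
    by (simp add: sum_divide_distrib miss_def)
  finally show ?case .
qed

text \<open>A window of radius \<open>r\<close> around a point of an interval of length at most \<open>r\<close> contains the
  whole interval.\<close>

lemma miss_le:
  assumes "u \<noteq> []" "finite F" "disjoint_family_on (\<lambda>(i, j). {i..<j}) F"
    and F: "\<And>i j. (i, j) \<in> F \<Longrightarrow>
      j \<le> length u \<and> blocking A s i (slice u i j) \<and> j - i \<le> r \<and> real r \<le> 2 * real (j - i)"
  shows "miss A u s r \<le> exp (- (real (card F) * real r / (2 * real (length u))))"
proof -
  let ?n = "length u"
  let ?bl = "\<lambda>x. blocking A s (x - r) (slice u (x - r) (min ?n (x + r)))"
  define H where "H = {x. x < ?n \<and> ?bl x}"
  have "(\<Union>(i, j)\<in>F. {i..<j}) \<subseteq> H"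
  proof safe
    fix i j x assume ij: "(i, j) \<in> F" and x: "x \<in> {i..<j}"
    have "?bl x"
      by (rule blocking_slice_mono[of A s i u j]) (use F[OF ij] x in auto)
    then show "x \<in> H" using F[OF ij] x unfolding H_def by auto
  qed
  then have "card (\<Union>(i, j)\<in>F. {i..<j}) \<le> card H"
    by (intro card_mono) (simp_all add: H_def)
  moreover have "card (\<Union>(i, j)\<in>F. {i..<j}) = (\<Sum>(i, j)\<in>F. j - i)"
    using assms(2,3) by (subst card_UN_disjoint')
      (auto simp: case_prod_beta)
  ultimately have "real (\<Sum>(i, j)\<in>F. j - i) \<le> card H" by linarith
  then have "(\<Sum>(i, j)\<in>F. real (j - i)) \<le> card H" by (simp add: case_prod_unfold)
  moreover have "(\<Sum>(i, j)\<in>F. real r / 2) \<le> (\<Sum>(i, j)\<in>F. real (j - i))"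
    by (rule sum_mono) (use F in fastforce)
  ultimately have H: "real (card F) * real r / 2 \<le> card H"
    by (simp add: case_prod_beta)
  have "{x. x < ?n \<and> \<not> ?bl x} = {..<?n} - H" by (auto simp: H_def)
  moreover have "H \<subseteq> {..<?n}" by (auto simp: H_def)
  ultimately have "real (card {x. x < ?n \<and> \<not> ?bl x}) = real ?n - card H"
    using card_mono[of "{..<?n}" H] by (simp add: card_Diff_subset finite_subset of_nat_diff)
  then have "miss A u s r = 1 - card H / ?n"
    using assms(1) by (simp add: miss_def diff_divide_distrib)
  also have "\<dots> \<le> exp (- (card H / ?n))"
    using exp_ge_add_one_self[of "- (card H / ?n)"] by simp
  also have "\<dots> \<le> exp (- (real (card F) * real r / 2 / ?n))"
    using divide_right_mono[OF H, of "real ?n"] by simp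
  finally show ?thesis by simp
qed

section \<open>Detection at dyadic scales\<close>

definition radii :: "nat \<Rightarrow> nat \<Rightarrow> nat list" where
  "radii c T = concat (map (\<lambda>t. replicate (c * 2 ^ (T - t)) (2 ^ t)) [0..<Suc T])"

text \<open>Every scale \<open>t\<close> contributes the same: \<open>c * 2 ^ (T - t)\<close>
  windows of radius \<open>2 ^ t\<close> add up to \<open>c * 2 ^ T\<close>.\<close>

lemma sum_list_radii: "sum_list (radii c T) = c * (T + 1) * 2 ^ T"
proof -
  have "sum_list (concat (map (\<lambda>t. replicate (h t) (2 ^ t)) ts)) =
      (\<Sum>t\<leftarrow>ts. h t * 2 ^ t)" for ts and h :: "nat \<Rightarrow> nat"
    by (induction ts) (auto simp: sum_list_replicate)
  then have "sum_list (radii c T) = (\<Sum>t\<leftarrow>[0..<Suc T]. c * 2 ^ (T - t) * 2 ^ t)"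
    unfolding radii_def .
  also have "\<dots> = (\<Sum>t\<leftarrow>[0..<Suc T]. c * 2 ^ T)"
    by (intro arg_cong[where f = sum_list] map_cong) (auto simp flip: power_add simp: mult.assoc)
  finally show ?thesis by (simp add: sum_list_triv algebra_simps)
qed

lemma prod_list_radii:
  fixes g :: "nat \<Rightarrow> real"
  shows "(\<Prod>r\<leftarrow>radii c T. g r) = (\<Prod>t\<le>T. g (2 ^ t) ^ (c * 2 ^ (T - t)))"
proof -
  have "(\<Prod>r\<leftarrow>concat (map (\<lambda>t. replicate (h t) (2 ^ t)) ts). g r) =
      (\<Prod>t\<leftarrow>ts. g (2 ^ t) ^ h t)" for ts and h :: "nat \<Rightarrow> nat"
    by (induction ts) auto
  then have "(\<Prod>r\<leftarrow>radii c T. g r) = (\<Prod>t\<leftarrow>[0..<Suc T]. g (2 ^ t) ^ (c * 2 ^ (T - t)))"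
    unfolding radii_def .
  also have "\<dots> = (\<Prod>t\<in>set [0..<Suc T]. g (2 ^ t) ^ (c * 2 ^ (T - t)))"
    by (rule prod.distinct_set_conv_list[symmetric]) simp
  also have "set [0..<Suc T] = {..T}" by auto
  finally show ?thesis .
qed

text \<open>The least \<open>t\<close> with \<open>l <= 2 ^ t\<close> works: minimality gives
  \<open>2 ^ (t - 1) < l\<close> for positive \<open>t\<close>, and \<open>t = 0\<close> uses
  \<open>1 <= l\<close>.\<close>

lemma dyadic_level:
  assumes "1 \<le> l" "l \<le> 2 ^ T"
  obtains t :: nat where "t \<le> T" "l \<le> 2 ^ t" "real (2 ^ t) \<le> 2 * real l"
proof -
  define t where "t = (LEAST t. l \<le> 2 ^ t)"
  have l: "l \<le> 2 ^ t" unfolding t_def using assms(2) by (rule LeastI)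
  have "t \<le> T" unfolding t_def using assms(2) by (rule Least_le)
  moreover have le: "2 ^ t \<le> 2 * l"
  proof (cases t)
    case (Suc t')
    then have "t' < t" by simp
    then have "\<not> l \<le> 2 ^ t'" unfolding t_def by (rule not_less_Least)
    with Suc show ?thesis by simp
  qed (use assms(1) in simp)
  have "real (2 ^ t) \<le> 2 * real l"
    using of_nat_mono[OF le, where 'a = real] by simp
  ultimately show ?thesis using l that by blast
qed

text \<open>At most \<open>length u / 2 ^ T\<close> factors are longer than \<open>2 ^ T\<close>,
  which by the hypothesis on \<open>card F\<close> is at most half of them. For the others, having
  fewer windows at larger scales is compensated by the larger target that each factor
  offers.\<close>

lemma many_blocking_imp_caught:
  assumes "u \<noteq> []" "finite F" "disjoint_family_on (\<lambda>(i, j). {i..<j}) F"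
    and F: "\<And>i j. (i, j) \<in> F \<Longrightarrow> i < j \<and> j \<le> length u \<and> blocking A s i (slice u i j)"
    and card: "2 * real (length u) \<le> 2 ^ T * real (card F)"
  shows "(\<Prod>r\<leftarrow>radii c T. miss A u s r) \<le> exp (- (real c / 2))"
proof -
  let ?n = "length u"
  \<comment> \<open>A factor whose length is a power of two can belong to two scales; only covering
    matters.\<close>
  define G where "G t = {(i, j)\<in>F. j - i \<le> 2 ^ t \<and> real (2 ^ t) \<le> 2 * real (j - i)}" for t :: nat
  define B where "B = {(i, j)\<in>F. 2 ^ T < j - i}"
  have GF: "G t \<subseteq> F" and BF: "B \<subseteq> F" for t by (auto simp: G_def B_def)
  have fin: "finite (G t)" "finite B" for t
    using assms(2) GF BF finite_subset by blast+
  have disj: "disjoint_family_on (\<lambda>(i, j). {i..<j}) F'" if "F' \<subseteq> F" for F'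
    using disjoint_family_on_mono[OF that assms(3)] .
  have "F \<subseteq> B \<union> (\<Union>t\<le>T. G t)"
  proof
    fix p assume "p \<in> F"
    obtain i j where p: "p = (i, j)" by (cases p)
    with \<open>p \<in> F\<close> have ij: "(i, j) \<in> F" by simp
    show "p \<in> B \<union> (\<Union>t\<le>T. G t)"
    proof (cases "2 ^ T < j - i")
      case False
      then have "1 \<le> j - i" "j - i \<le> 2 ^ T" using F[OF ij] by auto
      then obtain t where "t \<le> T" "j - i \<le> 2 ^ t" "real (2 ^ t) \<le> 2 * real (j - i)"
        by (rule dyadic_level)
      then show ?thesis using ij p unfolding G_def by auto
    qed (use ij p in \<open>simp add: B_def\<close>)
  qed
  then have "card F \<le> card (B \<union> (\<Union>t\<le>T. G t))"
    using fin by (intro card_mono) auto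
  also have "\<dots> \<le> card B + (\<Sum>t\<le>T. card (G t))"
    using card_Un_le[of B "\<Union>t\<le>T. G t"] card_UN_le[of "{..T}" G] by simp
  finally have F_le: "card F \<le> card B + (\<Sum>t\<le>T. card (G t))" .
  have "card B * 2 ^ T = (\<Sum>(i, j)\<in>B. 2 ^ T)" by (simp add: case_prod_unfold)
  also have "\<dots> \<le> (\<Sum>(i, j)\<in>B. j - i)"
    by (rule sum_mono) (auto simp: B_def)
  also have "\<dots> = card (\<Union>(i, j)\<in>B. {i..<j})"
    using fin(2) disj[OF BF] by (subst card_UN_disjoint') (auto simp: case_prod_unfold)
  also have "\<dots> \<le> card {..<?n}"
  proof (rule card_mono)
    show "(\<Union>(i, j)\<in>B. {i..<j}) \<subseteq> {..<?n}"
    proof safe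
      fix i j x assume "(i, j) \<in> B" "x \<in> {i..<j}"
      then show "x < ?n" using F[of i j] BF by auto
    qed
  qed simp
  finally have "card B * 2 ^ T \<le> ?n" by simp
  from of_nat_mono[OF this, where 'a = real]
  have B: "real (card B) * 2 ^ T \<le> ?n" by simp
  have "2 ^ T * real (card F) \<le> 2 ^ T * (real (card B) + (\<Sum>t\<le>T. real (card (G t))))"
  proof (rule mult_left_mono)
    show "real (card F) \<le> real (card B) + (\<Sum>t\<le>T. real (card (G t)))"
      using of_nat_mono[OF F_le, where 'a = real] by simp
  qed simp
  then have large: "real ?n \<le> 2 ^ T * (\<Sum>t\<le>T. real (card (G t)))"
    using B card by (simp add: algebra_simps)
  have level: "miss A u s (2 ^ t) ^ (c * 2 ^ (T - t)) \<le>
      exp (- (real c * 2 ^ T * real (card (G t)) / (2 * real ?n)))" if "t \<le> T" for t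
  proof -
    have "miss A u s (2 ^ t) \<le> exp (- (real (card (G t)) * real (2 ^ t) / (2 * real ?n)))"
      by (rule miss_le[OF assms(1) fin(1) disj[OF GF]]) (use F in \<open>auto simp: G_def\<close>)
    then have "miss A u s (2 ^ t) ^ (c * 2 ^ (T - t)) \<le>
        exp (- (real (card (G t)) * real (2 ^ t) / (2 * real ?n))) ^ (c * 2 ^ (T - t))"
      using miss_nonneg by (rule power_mono)
    also have "\<dots> = exp (real (c * 2 ^ (T - t)) * - (real (card (G t)) * real (2 ^ t) / (2 * real ?n)))"
      by (rule exp_of_nat_mult[symmetric])
    also have "real (c * 2 ^ (T - t)) * - (real (card (G t)) * real (2 ^ t) / (2 * real ?n)) =
        - (real c * (2 ^ (T - t) * 2 ^ t) * real (card (G t)) / (2 * real ?n))"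
      by simp
    \<comment> \<open>The scale cancels: every exponent carries the same \<open>2 ^ T\<close>, so
      the exponents of all scales can be added.\<close>
    also have "(2::real) ^ (T - t) * 2 ^ t = 2 ^ T"
      using that by (simp flip: power_add)
    finally show ?thesis .
  qed
  have "(\<Prod>r\<leftarrow>radii c T. miss A u s r) \<le>
      (\<Prod>t\<le>T. exp (- (real c * 2 ^ T * real (card (G t)) / (2 * real ?n))))"
    unfolding prod_list_radii using level by (intro prod_mono conjI zero_le_power miss_nonneg) auto
  also have "\<dots> = exp (- (real c / 2 * ((2 ^ T * (\<Sum>t\<le>T. real (card (G t)))) / ?n)))"
    by (subst exp_sum[symmetric])
      (simp_all add: sum_negf sum_divide_distrib sum_distrib_left mult_ac)
  also have "\<dots> \<le> exp (- (real c / 2 * 1))"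
  proof -
    have "1 \<le> (2 ^ T * (\<Sum>t\<le>T. real (card (G t)))) / ?n"
      using large assms(1) by (simp add: le_divide_eq)
    then have "real c / 2 * 1 \<le> real c / 2 * ((2 ^ T * (\<Sum>t\<le>T. real (card (G t)))) / ?n)"
      by (rule mult_left_mono) simp
    then show ?thesis by (subst exp_le_cancel_iff) (rule le_imp_neg_le)
  qed
  finally show ?thesis by simp
qed

text \<open>Farness and \<open>greedy_repair\<close> give
  \<open>\<epsilon> * length u <= N * (card F + 2)\<close>. As
  \<open>4 * N <= \<epsilon> * 2 ^ T\<close> and \<open>2 ^ T <= length u\<close>, the extra
  \<open>2 * N\<close> is at most half of the left side. Multiplying what remains by
  \<open>4 * N <= \<epsilon> * 2 ^ T\<close> yields the count that
  \<open>many_blocking_imp_caught\<close> asks for.\<close>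

lemma far_imp_caught:
  assumes N: "connecting A N"
    and u: "walk A s f (length u)" "far \<epsilon> u (path_lang A s f)"
    and T: "0 < \<epsilon>" "4 * real N / \<epsilon> \<le> 2 ^ T" "N \<le> 2 ^ T" "2 ^ T \<le> length u"
  shows "(\<Prod>r\<leftarrow>radii c T. miss A u s r) \<le> exp (- (real c / 2))"
proof -
  let ?n = "length u"
  have "0 + N \<le> ?n" using T(3,4) by simp
  from greedy_repair[OF N u(1) walk_refl this, of u]
  obtain v F where v: "length v = ?n - 0" "f \<in> reached A {s} v" and F: "finite F"
      "\<forall>(i, j)\<in>F. 0 < i \<and> i < j \<and> j \<le> ?n \<and> blocking A s i (slice u i j)"
      "disjoint_family_on (\<lambda>(i, j). {i..<j}) F"
    and m: "mismatches (slice u 0 ?n) v \<le> N * (card F + 2)"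
    by (elim exE conjE)
  have "ereal (\<epsilon> * ?n) \<le> hamming u v"
    using u(2) v(2) unfolding far_def path_lang_def by blast
  then have "\<epsilon> * ?n \<le> mismatches u v"
    using v(1) by (simp add: hamming_eq_mismatches)
  also have "\<dots> \<le> real N * (real (card F) + 2)"
    using of_nat_mono[OF m, where 'a = real] unfolding slice_all by (simp add: algebra_simps)
  finally have \<epsilon>n: "\<epsilon> * ?n \<le> real N * (real (card F) + 2)" .
  have N\<epsilon>: "4 * real N \<le> \<epsilon> * 2 ^ T" using T(1,2) by (simp add: field_simps)
  have n: "2 ^ T \<le> real ?n"
    using of_nat_mono[OF T(4), where 'a = real] by simp
  have "\<epsilon> * 2 ^ T \<le> \<epsilon> * ?n" using n T(1) by simp
  with N\<epsilon> \<epsilon>n have F_ge: "\<epsilon> * ?n \<le> 2 * (real N * real (card F))"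
    by (simp add: algebra_simps)
  have "(4 * real N) * (\<epsilon> * ?n) \<le> (\<epsilon> * 2 ^ T) * (2 * (real N * real (card F)))"
    by (rule mult_mono[OF N\<epsilon> F_ge]) (use T(1) in simp_all)
  then have "(2 * real N * \<epsilon>) * (2 * real ?n) \<le> (2 * real N * \<epsilon>) * (2 ^ T * real (card F))"
    by (simp add: algebra_simps)
  then have "2 * real ?n \<le> 2 ^ T * real (card F)"
    using T(1) connecting_ge_1[OF N] by (subst (asm) mult_le_cancel_left_pos) auto
  moreover have "u \<noteq> []" using T(4) by (cases u) auto
  ultimately show ?thesis
    using F by (intro many_blocking_imp_caught[of u F]) auto
qed

section \<open>Correctness and cost of the tester\<close>

definition tester :: "('q, 'a) nfa \<Rightarrow> nat \<Rightarrow> nat \<Rightarrow> nat \<Rightarrow> 'a query_alg" where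
  "tester A c T n =
    (if n < 2 ^ T then read_all [0..<n] (\<lambda>w. Answer (w \<in> lang A))
     else probe A n (radii c T) {s\<in>init A. \<exists>f\<in>final A. walk A s f n})"

lemma run_read_everything:
  "run (read_all [0..<length u] (\<lambda>w. Answer (w \<in> L))) u = return_pmf (u \<in> L, length u)"
  by (simp add: run_read_all map_nth)

text \<open>Words shorter than \<open>2 ^ T\<close> are read completely; \<open>c + 1\<close>
  instead of \<open>c\<close> leaves room for them even when \<open>c = 0\<close>.\<close>

lemma tester_uses_at_most: "uses_at_most (tester A c T) (2 * (c + 1) * (T + 1) * 2 ^ T)"
  unfolding uses_at_most_def
proof safe
  fix u b k assume run: "(b, k) \<in> set_pmf (run (tester A c T (length u)) u)"
  show "k \<le> 2 * (c + 1) * (T + 1) * 2 ^ T"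
  proof (cases "length u < 2 ^ T")
    case True
    then have "k < 2 ^ T"
      using run by (simp add: tester_def run_read_everything)
    also have "2 ^ T \<le> 2 * (c + 1) * (T + 1) * 2 ^ T" by simp
    finally show ?thesis by simp
  next
    case False
    then have "k \<le> 2 * (c * (T + 1) * 2 ^ T)"
      using run probe_queries unfolding tester_def sum_list_radii[symmetric] by force
    also have "\<dots> \<le> 2 * (c + 1) * (T + 1) * 2 ^ T" by (simp add: algebra_simps)
    finally show ?thesis .
  qed
qed

text \<open>The factor \<open>6 * CARD('q)\<close> bounds the survival probability of each state by
  \<open>exp (- (3 * CARD('q)))\<close>, so the union bound over at most \<open>CARD('q)\<close>
  states gives at most \<open>1 / 3\<close>.\<close>

lemma is_tester_tester:
  fixes A :: "('q::finite, 'a) nfa"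
  assumes N: "connecting A N"
    and T: "0 < \<epsilon>" "4 * real N / \<epsilon> \<le> 2 ^ T" "N \<le> 2 ^ T"
  shows "is_tester \<epsilon> (lang A) (tester A (6 * CARD('q)) T)"
  unfolding is_tester_def
proof (intro conjI allI impI)
  fix u assume u: "u \<in> lang A"
  then obtain s f where sf: "s \<in> init A" "f \<in> final A" "u \<in> path_lang A s f"
    unfolding lang_eq_UN by blast
  then have "walk A s f (length u)" by (auto simp: path_lang_def intro: walkI)
  then have s: "s \<in> {s\<in>init A. \<exists>f\<in>final A. walk A s f (length u)}"
    using sf by blast
  show "\<forall>(b, c)\<in>set_pmf (run (tester A (6 * CARD('q)) T (length u)) u). b"
  proof (cases "length u < 2 ^ T")
    case True
    then show ?thesis using u by (simp add: tester_def run_read_everything)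
  next
    case False
    then have "u \<noteq> []" by (cases u) auto
    then show ?thesis
      using False probe_accepts[OF _ s sf(3)] unfolding tester_def by auto
  qed
next
  fix u assume u: "u \<notin> lang A \<and> far \<epsilon> u (lang A)"
  let ?R = "run (tester A (6 * CARD('q)) T (length u)) u"
  show "measure_pmf.prob ?R {(b, c). \<not> b} \<ge> 2 / 3"
  proof (cases "length u < 2 ^ T")
    case True
    then show ?thesis
      using u by (simp add: tester_def run_read_everything measure_return_pmf)
  next
    case False
    \<comment> \<open>States without a walk of length \<open>length u\<close> to a final state are
      discarded in advance, since \<open>far_imp_caught\<close> repairs along such a walk.\<close>
    define S where "S = {s\<in>init A. \<exists>f\<in>final A. walk A s f (length u)}"
    have caught: "(\<Prod>r\<leftarrow>radii (6 * CARD('q)) T. miss A u s r) \<le> exp (- (3 * real CARD('q)))"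
      if s: "s \<in> S" for s
    proof -
      obtain f where f: "s \<in> init A" "f \<in> final A" "walk A s f (length u)"
        using s unfolding S_def by blast
      then have "far \<epsilon> u (path_lang A s f)"
        using u unfolding far_def lang_eq_UN by blast
      from far_imp_caught[OF N f(3) this T, where c = "6 * CARD('q)"] False
      show ?thesis by simp
    qed
    have "u \<noteq> []" using False by (cases u) auto
    then have "measure_pmf.prob ?R {(b, c). b} \<le>
        (\<Sum>s\<in>S. \<Prod>r\<leftarrow>radii (6 * CARD('q)) T. miss A u s r)"
      using False probe_prob_accept unfolding tester_def S_def by simp
    also have "\<dots> \<le> (\<Sum>s\<in>S. exp (- (3 * real CARD('q))))"
      by (rule sum_mono) (rule caught)
    also have "\<dots> \<le> CARD('q) * exp (- (3 * real CARD('q)))"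
      by (simp add: card_mono)
    also have "\<dots> \<le> 1 / 3"
    proof -
      have "3 * real CARD('q) \<le> exp (3 * real CARD('q))"
        using exp_ge_add_one_self[of "3 * real CARD('q)"] by linarith
      then show ?thesis by (simp add: exp_minus field_simps)
    qed
    finally have "measure_pmf.prob ?R {(b, c). b} \<le> 1 / 3" .
    moreover have "{(b, c). \<not> b} = UNIV - {(b, c :: nat). b}" by auto
    ultimately show ?thesis
      by (simp add: measure_pmf.prob_compl[of "{(b, c). b}", simplified])
  qed
qed

section \<open>Asymptotics of the query bound\<close>

lemma power_of_two_between:
  assumes "1 \<le> (x::real)"
  shows "x \<le> 2 ^ nat \<lceil>log 2 x\<rceil>" "(2::real) ^ nat \<lceil>log 2 x\<rceil> \<le> 2 * x"
    "real (nat \<lceil>log 2 x\<rceil>) \<le> log 2 x + 1"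
proof -
  have "0 \<le> log 2 x" using assms by simp
  then have *: "log 2 x \<le> real (nat \<lceil>log 2 x\<rceil>)" "real (nat \<lceil>log 2 x\<rceil>) \<le> log 2 x + 1"
    by linarith+
  have "x = 2 powr log 2 x" using assms by simp
  also have "\<dots> \<le> 2 powr real (nat \<lceil>log 2 x\<rceil>)" using * by simp
  finally show "x \<le> 2 ^ nat \<lceil>log 2 x\<rceil>" by (simp add: powr_realpow)
  have "2 powr real (nat \<lceil>log 2 x\<rceil>) \<le> 2 powr (log 2 x + 1)" using * by simp
  also have "\<dots> = 2 * x" using assms by (simp add: powr_add)
  finally show "(2::real) ^ nat \<lceil>log 2 x\<rceil> \<le> 2 * x" by (simp add: powr_realpow)
  show "real (nat \<lceil>log 2 x\<rceil>) \<le> log 2 x + 1" by fact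
qed

lemma cost_in_bigo:
  assumes "0 < (K::real)"
  shows "(\<lambda>\<epsilon>. (ln (4 * K / \<epsilon> + K) / ln 2 + 2) * (4 * K / \<epsilon> + K))
    \<in> O[at_right 0](\<lambda>\<epsilon>. (1 / \<epsilon>) * ln (1 / \<epsilon>))"
  using assms by real_asymp

text \<open>\<open>q\<close> is fixed before \<open>\<epsilon>\<close>, so the hidden constant
  depends on \<open>A\<close> alone. The bound is taken as \<open>\<epsilon>\<close> tends to
  \<open>0\<close>, because \<open>ln (1 / \<epsilon>)\<close> vanishes at
  \<open>\<epsilon> = 1\<close>.\<close>

theorem theorem16:
  fixes A :: "('q::finite, 'a::finite) nfa"
  assumes "strongly_connected A"
  shows "\<exists>q :: real \<Rightarrow> nat.
    (\<lambda>\<epsilon>. real (q \<epsilon>)) \<in> O[at_right 0](\<lambda>\<epsilon>. (1 / \<epsilon>) * ln (1 / \<epsilon>)) \<and>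
    (\<forall>\<epsilon>>0. \<exists>T. is_tester \<epsilon> (lang A) T \<and> uses_at_most T (q \<epsilon>))"
proof -
  obtain N where N: "connecting A N"
    using strongly_connected_imp_connecting[OF assms] .
  define c where "c = 6 * CARD('q)"
  \<comment> \<open>A single power of two above this sum exceeds both
    \<open>4 * N / \<epsilon>\<close> and \<open>N\<close>, as \<open>is_tester_tester\<close>
    requires; the summand \<open>N\<close> also keeps the logarithm nonnegative.\<close>
  define x where "x \<epsilon> = 4 * real N / \<epsilon> + real N" for \<epsilon>
  define T where "T \<epsilon> = nat \<lceil>log 2 (x \<epsilon>)\<rceil>" for \<epsilon>
  define q where "q \<epsilon> = 2 * (c + 1) * (T \<epsilon> + 1) * 2 ^ T \<epsilon>" for \<epsilon>
  have x: "x \<epsilon> \<ge> 1" if "\<epsilon> > 0" for \<epsilon>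
    using that connecting_ge_1[OF N] unfolding x_def by (simp add: add_increasing)
  have "is_tester \<epsilon> (lang A) (tester A c (T \<epsilon>))" if "\<epsilon> > 0" for \<epsilon>
  proof -
    have xT: "x \<epsilon> \<le> 2 ^ T \<epsilon>"
      unfolding T_def using power_of_two_between(1)[OF x[OF that]] .
    moreover have "4 * real N / \<epsilon> \<le> x \<epsilon>" "real N \<le> x \<epsilon>" using that by (simp_all add: x_def)
    ultimately have \<epsilon>T: "4 * real N / \<epsilon> \<le> 2 ^ T \<epsilon>" and "real N \<le> 2 ^ T \<epsilon>" by linarith+
    then have "real N \<le> real (2 ^ T \<epsilon>)" by simp
    then have "N \<le> 2 ^ T \<epsilon>" unfolding of_nat_le_iff .
    then show ?thesis
      unfolding c_def by (rule is_tester_tester[OF N that \<epsilon>T])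
  qed
  moreover have "uses_at_most (tester A c (T \<epsilon>)) (q \<epsilon>)" for \<epsilon>
    unfolding q_def by (rule tester_uses_at_most)
  moreover have "(\<lambda>\<epsilon>. real (q \<epsilon>)) \<in> O[at_right 0](\<lambda>\<epsilon>. (1 / \<epsilon>) * ln (1 / \<epsilon>))"
  proof (rule landau_o.big.trans)
    have "real (q \<epsilon>) \<le> 2 * (real c + 1) * ((log 2 (x \<epsilon>) + 2) * (2 * x \<epsilon>))" if "\<epsilon> > 0" for \<epsilon>
    proof -
      have "(real (T \<epsilon>) + 1) * 2 ^ T \<epsilon> \<le> (log 2 (x \<epsilon>) + 2) * (2 * x \<epsilon>)"
        unfolding T_def
      proof (rule mult_mono)
        show "real (nat \<lceil>log 2 (x \<epsilon>)\<rceil>) + 1 \<le> log 2 (x \<epsilon>) + 2"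
          using power_of_two_between(3)[OF x[OF that]] by linarith
        show "2 ^ nat \<lceil>log 2 (x \<epsilon>)\<rceil> \<le> 2 * x \<epsilon>"
          using power_of_two_between(2)[OF x[OF that]] .
        show "0 \<le> log 2 (x \<epsilon>) + 2" using x[OF that] by (simp add: add_nonneg_nonneg)
      qed simp
      then have "2 * (real c + 1) * ((real (T \<epsilon>) + 1) * 2 ^ T \<epsilon>) \<le>
          2 * (real c + 1) * ((log 2 (x \<epsilon>) + 2) * (2 * x \<epsilon>))"
        by (rule mult_left_mono) simp
      also have "2 * (real c + 1) * ((real (T \<epsilon>) + 1) * 2 ^ T \<epsilon>) = real (q \<epsilon>)"
        by (simp add: q_def algebra_simps)
      finally show ?thesis .
    qed
    then have "norm (real (q \<epsilon>)) \<le> 4 * (real c + 1) * norm ((log 2 (x \<epsilon>) + 2) * x \<epsilon>)"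
      if "\<epsilon> > 0" for \<epsilon>
      using that x[OF that] by (simp add: algebra_simps)
    then have "\<forall>\<^sub>F \<epsilon> in at_right 0.
        norm (real (q \<epsilon>)) \<le> 4 * (real c + 1) * norm ((log 2 (x \<epsilon>) + 2) * x \<epsilon>)"
      unfolding eventually_at_right_field by (intro exI[of _ 1]) simp
    then show "(\<lambda>\<epsilon>. real (q \<epsilon>)) \<in> O[at_right 0](\<lambda>\<epsilon>. (log 2 (x \<epsilon>) + 2) * x \<epsilon>)"
      by (rule bigoI)
    show "(\<lambda>\<epsilon>. (log 2 (x \<epsilon>) + 2) * x \<epsilon>) \<in> O[at_right 0](\<lambda>\<epsilon>. (1 / \<epsilon>) * ln (1 / \<epsilon>))"
      unfolding x_def log_def by (rule cost_in_bigo) (use connecting_ge_1[OF N] in simp)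
  qed
  ultimately show ?thesis by blast
qed

end
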